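(* Let $\boldsymbol{z}'=(z'_1,\dots,z'_N)$ be a projected coarse solution of $P(\widetilde{\boldsymbol{d}};\widetilde{\boldsymbol{G}},\widetilde{\boldsymbol{p}})$. Define $\boldsymbol{d}'=(d'_1,\dots,d'_N)\in\mathbb{R}^{mN}$ by $$d'_i:=\begin{cases} d_i & \text{if } i\in\mathbb{S},\\ G_{i,i-1}z'_{i-1}+G_{i,i}z'_i & \text{otherwise.}\end{cases}$$ Then there exists a solution (minimizer) of $P(\boldsymbol{d}';\boldsymbol{G},\boldsymbol{p})$, and every solution of $P(\boldsymbol{d}';\boldsymbol{G},\boldsymbol{p})$ is a projected coarse solution of $P(\widetilde{\boldsymbol{d}};\widetilde{\boldsymbol{G}},\widetilde{\boldsymbol{p}})$.
   Context: Problem. Fix a horizon $N\ge 1$, dimensions $n_x,n_u,n_w$, and real matrices $A_i\in\mathbb{R}^{n_x\times n_x}$, $B_i\in\mathbb{R}^{n_x\times n_u}$ ($1\le i\le N-1$), $E_i\in\mathbb{R}^{n_w\times n_x}$, $F_i\in\mathbb{R}^{n_w\times n_u}$ ($1\le i\le N$). Set $n:=n_x+n_u$ and $m:=4n_x+2n_u+2n_w$. For $1\le i\le N$ let $G_{i,i}\in\mathbb{R}^{m\times n}$ be the matrix whose block rows, in order, are $[I_{n_x}\;0]$, $[-I_{n_x}\;0]$, $[E_i\;F_i]$, $[-E_i\;-F_i]$, $[I_{n_x}\;0]$, $[-I_{n_x}\;0]$, $[0\;I_{n_u}]$, $[0\;-I_{n_u}]$. For $2\le i\le N$ let $G_{i,i-1}\in\mathbb{R}^{m\times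 n}$ be the matrix whose first two block rows (each of height $n_x$) are $[-A_{i-1}\;-B_{i-1}]$ and $[A_{i-1}\;B_{i-1}]$ and whose remaining rows are zero. Set $G_{i,j}:=0$ for all other $i,j$ (in particular $G_{1,0}:=0$, and $z'_0:=0$). Let $\boldsymbol{G}:=(G_{i,j})_{i,j=1}^N\in\mathbb{R}^{mN\times nN}$, and fix $\boldsymbol{p}\in\mathbb{R}^{nN}$ and $\boldsymbol{d}=(d_1,\dots,d_N)\in\mathbb{R}^{mN}$, $d_i\in\mathbb{R}^m$. For any data $(\boldsymbol{d};\boldsymbol{G},\boldsymbol{p})$ of compatible sizes, $P(\boldsymbol{d};\boldsymbol{G},\boldsymbol{p})$ denotes the linear program $\min_{\boldsymbol{z}}\boldsymbol{p}^\top\boldsymbol{z}$ s.t. $\boldsymbol{G}\boldsymbol{z}\ge\boldsymbol{d}$ (componentwise). Coarse problem. Fix a coarse grid $\{M_1=1<M_2<\cdots<M_K\}\subseteq\{1,\dots,N\}$; put $M_{K+1}:=N+1$, $N_k:=M_{k+1}-1$, $L_k:=N_k-M_k+1$, so the integer intervals $\{M_k,\dots,N_k\}$ partition $\{1,\dots,N\}$. Let $T:=\mathrm{diag}(T_1,\dots,T_K)\in\mathbb{R}^{nN\times nK}$ and $U:=\mathrm{diag}(U_1,\dots,U_K)\in\mathbb{R}^{mN\times mK}$ be block diagonal, where $T_k\in\mathbb{R}^{nL_k\times n}$ is $L_k^{-1/2}$ times $L_k$ stacked copies of $I_n$, and $U_k\in\mathbb{R}^{mL_k\times m}$ is $L_k^{-1/2}$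 times $L_k$ stacked copies of $I_m$. Fix a primal-dual prior guess $(\boldsymbol{z}^o,\boldsymbol{\lambda}^o)\in\mathbb{R}^{nN}\times\mathbb{R}^{mN}$, $\boldsymbol{\lambda}^o=(\lambda^o_1,\dots,\lambda^o_N)$, $\lambda^o_i\in\mathbb{R}^m$. The coarse problem is $P(\widetilde{\boldsymbol{d}};\widetilde{\boldsymbol{G}},\widetilde{\boldsymbol{p}})$ with $\widetilde{\boldsymbol{p}}:=T^\top(\boldsymbol{p}-\boldsymbol{G}^\top\boldsymbol{\lambda}^o)$, $\widetilde{\boldsymbol{d}}:=U^\top(\boldsymbol{d}-\boldsymbol{G}\boldsymbol{z}^o)$, $\widetilde{\boldsymbol{G}}:=U^\top\boldsymbol{G}T$. A projected coarse solution is a vector $\boldsymbol{z}'=\boldsymbol{z}^o+T\widetilde{\boldsymbol{z}}^*\in\mathbb{R}^{nN}$ where $\widetilde{\boldsymbol{z}}^*\in\mathbb{R}^{nK}$ is an optimal solution of the coarse problem. Free indices. $\widetilde{\mathbb{S}}:=\{k\in\{1,\dots,K\}: L_k=1\text{ and }\lambda^o_{M_k}=0\}$ and $\mathbb{S}:=\bigcup_{k\in\widetilde{\mathbb{S}}}\{M_k,\dots,N_k\}\subseteq\{1,\dots,N\}$. *)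

theory Defs
  imports Complex_Main "Jordan_Normal_Form.Matrix"
begin

text \<open>Matrices and vectors are those of \<^theory>\<open>Jordan_Normal_Form.Matrix\<close>, whose entries are
  indexed from 0. Stages and grid points are numbered from 1, so block \<open>i\<close> of a vector
  with blocks of size \<open>b\<close> occupies the entries \<open>(i - 1) * b, \<dots>, i * b - 1\<close>.\<close>

definition append_cols :: "real mat \<Rightarrow> real mat \<Rightarrow> real mat"  (infixr "@\<^sub>c" 66) where
  "A @\<^sub>c B = four_block_mat A B (0\<^sub>m 0 (dim_col A)) (0\<^sub>m 0 (dim_col B))"

definition block_mat :: "nat \<Rightarrow> nat \<Rightarrow> nat \<Rightarrow> nat \<Rightarrow> (nat \<Rightarrow> nat \<Rightarrow> real mat) \<Rightarrow> real mat" where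
  "block_mat br bc R C Q =
     mat (br * R) (bc * C) (\<lambda>(r, c). Q (r div br + 1) (c div bc + 1) $$ (r mod br, c mod bc))"

definition block_vec :: "nat \<Rightarrow> nat \<Rightarrow> (nat \<Rightarrow> real vec) \<Rightarrow> real vec" where
  "block_vec b R v = vec (b * R) (\<lambda>r. v (r div b + 1) $ (r mod b))"

text \<open>Block 0 is zero by convention, which gives \<open>z'\<^sub>0 = 0\<close>.\<close>

definition block :: "nat \<Rightarrow> real vec \<Rightarrow> nat \<Rightarrow> real vec" where
  "block b v i = (if i = 0 then 0\<^sub>v b else vec b (\<lambda>r. v $ ((i - 1) * b + r)))"


subsection \<open>Linear programs\<close>

definition lp_feasible :: "real vec \<Rightarrow> real mat \<Rightarrow> real vec \<Rightarrow> bool" where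
  "lp_feasible d G z \<longleftrightarrow> z \<in> carrier_vec (dim_col G) \<and> G *\<^sub>v z \<ge> d"

definition lp_solution :: "real vec \<Rightarrow> real mat \<Rightarrow> real vec \<Rightarrow> real vec \<Rightarrow> bool" where
  "lp_solution d G p z \<longleftrightarrow>
     lp_feasible d G z \<and> (\<forall>y. lp_feasible d G y \<longrightarrow> p \<bullet> z \<le> p \<bullet> y)"


subsection \<open>The constraint matrix\<close>

text \<open>Here \<open>E\<close>, \<open>F\<close> (and below \<open>A\<close>, \<open>B\<close>) are the matrices of a single stage.\<close>

definition G_diag :: "nat \<Rightarrow> nat \<Rightarrow> nat \<Rightarrow> real mat \<Rightarrow> real mat \<Rightarrow> real mat" where
  "G_diag nx nu nw E F =
     (1\<^sub>m nx @\<^sub>c 0\<^sub>m nx nu) @\<^sub>r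
     (- 1\<^sub>m nx @\<^sub>c 0\<^sub>m nx nu) @\<^sub>r
     (E @\<^sub>c F) @\<^sub>r
     (- E @\<^sub>c - F) @\<^sub>r
     (1\<^sub>m nx @\<^sub>c 0\<^sub>m nx nu) @\<^sub>r
     (- 1\<^sub>m nx @\<^sub>c 0\<^sub>m nx nu) @\<^sub>r
     (0\<^sub>m nu nx @\<^sub>c 1\<^sub>m nu) @\<^sub>r
     (0\<^sub>m nu nx @\<^sub>c - 1\<^sub>m nu)"

definition G_sub :: "nat \<Rightarrow> nat \<Rightarrow> nat \<Rightarrow> real mat \<Rightarrow> real mat \<Rightarrow> real mat" where
  "G_sub nx nu nw A B =
     (- A @\<^sub>c - B) @\<^sub>r
     (A @\<^sub>c B) @\<^sub>r
     0\<^sub>m (2 * nx + 2 * nu + 2 * nw) (nx + nu)"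

definition G_block :: "nat \<Rightarrow> nat \<Rightarrow> nat \<Rightarrow> (nat \<Rightarrow> real mat) \<Rightarrow> (nat \<Rightarrow> real mat) \<Rightarrow>
    (nat \<Rightarrow> real mat) \<Rightarrow> (nat \<Rightarrow> real mat) \<Rightarrow> nat \<Rightarrow> nat \<Rightarrow> real mat" where
  "G_block nx nu nw A B E F i j =
     (if j = i then G_diag nx nu nw (E i) (F i)
      else if 2 \<le> i \<and> j = i - 1 then G_sub nx nu nw (A (i - 1)) (B (i - 1))
      else 0\<^sub>m (4 * nx + 2 * nu + 2 * nw) (nx + nu))"


subsection \<open>The coarse grid\<close>

definition coarse_grid :: "nat \<Rightarrow> nat \<Rightarrow> (nat \<Rightarrow> nat) \<Rightarrow> bool" where
  "coarse_grid N K M \<longleftrightarrow>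
     1 \<le> K \<and> M 1 = 1 \<and> strict_mono_on {1..K} M \<and> M ` {1..K} \<subseteq> {1..N}"

text \<open>\<open>N\<^sub>k = M\<^sub>k\<^sub>+\<^sub>1 - 1\<close> with \<open>M\<^sub>K\<^sub>+\<^sub>1 = N + 1\<close>; only the values of \<open>M\<close> on \<open>{1..K}\<close> are used.\<close>

definition interval_end :: "nat \<Rightarrow> nat \<Rightarrow> (nat \<Rightarrow> nat) \<Rightarrow> nat \<Rightarrow> nat" where
  "interval_end N K M k = (if k = K then N + 1 else M (k + 1)) - 1"

definition interval_length :: "nat \<Rightarrow> nat \<Rightarrow> (nat \<Rightarrow> nat) \<Rightarrow> nat \<Rightarrow> nat" where
  "interval_length N K M k = interval_end N K M k - M k + 1"

definition stacked_identity :: "nat \<Rightarrow> nat \<Rightarrow> real mat" where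
  "stacked_identity b L = (1 / sqrt (real L)) \<cdot>\<^sub>m block_mat b b L 1 (\<lambda>_ _. 1\<^sub>m b)"

text \<open>The matrix \<open>T\<close> for block size \<open>b = n\<close>, and \<open>U\<close> for block size \<open>b = m\<close>.\<close>

definition prolongation :: "nat \<Rightarrow> nat \<Rightarrow> nat \<Rightarrow> (nat \<Rightarrow> nat) \<Rightarrow> real mat" where
  "prolongation b N K M =
     diag_block_mat (map (\<lambda>k. stacked_identity b (interval_length N K M k)) [1..<K + 1])"

definition projected_coarse_solution :: "real mat \<Rightarrow> real mat \<Rightarrow> real mat \<Rightarrow> real vec \<Rightarrow> real vec \<Rightarrow>
    real vec \<Rightarrow> real vec \<Rightarrow> real vec \<Rightarrow> bool" where
  "projected_coarse_solution T U G d p zo lo z \<longleftrightarrow>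
     (\<exists>y. lp_solution
            (transpose_mat U *\<^sub>v (d - G *\<^sub>v zo))
            (transpose_mat U * G * T)
            (transpose_mat T *\<^sub>v (p - transpose_mat G *\<^sub>v lo)) y
          \<and> z = zo + T *\<^sub>v y)"


subsection \<open>Free indices\<close>

definition free_coarse :: "nat \<Rightarrow> nat \<Rightarrow> nat \<Rightarrow> (nat \<Rightarrow> nat) \<Rightarrow> real vec \<Rightarrow> nat set" where
  "free_coarse m N K M lo =
     {k \<in> {1..K}. interval_length N K M k = 1 \<and> block m lo (M k) = 0\<^sub>v m}"

definition free_indices :: "nat \<Rightarrow> nat \<Rightarrow> nat \<Rightarrow> (nat \<Rightarrow> nat) \<Rightarrow> real vec \<Rightarrow> nat set" where
  "free_indices m N K M lo = (\<Union>k \<in> free_coarse m N K M lo. {M k..interval_end N K M k})"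

end

theory Submission
  imports Defs
begin

text \<open>Why the result holds. Every row of a stage in \<open>G\<close> occurs together with its negative, and the
  stage's own variables \<open>z\<^sub>i\<close> are among these rows. On a stage that is not free, \<open>d'\<close> is the value
  of the rows at \<open>z'\<close>, so feasibility for \<open>d'\<close> turns the inequalities of that stage into equalities:
  the rows take their values at \<open>z'\<close> and \<open>z\<^sub>i = z'\<^sub>i\<close> (\<open>stage_rows_pinned\<close>). Three consequences
  hold for every \<open>z\<close> feasible for \<open>d'\<close>.

  \<^item> \<open>z - z'\<close> is supported on the free stages, each of which is a coarse interval of its own. Hence
    it lies in the range of \<open>T\<close> (\<open>in_range_prolongation\<close>), and \<open>z = zo + T y\<close> for some \<open>y\<close>.

  \<^item> \<open>y\<close> is feasible for the coarse problem. The entries of \<open>U\<close> are nonnegative, so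
    \<open>U\<^sup>T G z \<ge> U\<^sup>T d'\<close>; and \<open>U\<^sup>T d' \<ge> U\<^sup>T d\<close>, because on a free interval \<open>d'\<close> agrees with \<open>d\<close>, and
    on any other interval it agrees with \<open>G z'\<close>, where \<open>z'\<close> satisfies the coarse constraints.

  \<^item> \<open>lo \<bullet> G z = lo \<bullet> G z'\<close>, because \<open>lo\<close> vanishes on the free stages and \<open>G z = G z'\<close> on the
    others. The coarse objective at \<open>y\<close> is \<open>(p - G\<^sup>T lo) \<bullet> (z - zo)\<close>, so it differs from \<open>p \<bullet> z\<close>
    by a constant.

  So the feasible set for \<open>d'\<close> embeds into that of the coarse problem, with the same objective up to a
  constant, and it contains the coarse optimum \<open>z'\<close>: on a free interval the coarse constraints
  are the constraints of \<open>P(d; G, p)\<close> themselves. Therefore \<open>z'\<close> is a minimizer, and every other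
  minimizer attains the coarse optimal value (\<open>solutions_transfer_to_coarse\<close>).\<close>

section \<open>Block matrices acting on vectors\<close>

lemma block_carrier: "block b v i \<in> carrier_vec b"
  by (simp add: block_def)

lemma block_index:
  fixes r b N :: nat
  assumes "r < b * N"
  shows "block b v (r div b + 1) $ (r mod b) = v $ r"
proof -
  have "0 < b" using assms by (cases b) auto
  then show ?thesis by (simp add: block_def)
qed

lemma block_row_index:
  fixes r b N :: nat
  assumes "r < b * N"
  shows "r div b + 1 \<in> {1..N}" and "r mod b < b"
proof -
  have "0 < b" using assms by (cases b) auto
  then show "r mod b < b" by simp
  show "r div b + 1 \<in> {1..N}"
    using assms by (auto simp: less_mult_imp_div_less mult.commute Suc_le_eq)
qed

lemma block_mat_mult_vec_index:
  assumes r: "r < br * R" and z: "z \<in> carrier_vec (bc * C)"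
    and Q: "\<And>j. j \<in> {1..C} \<Longrightarrow> Q (r div br + 1) j \<in> carrier_mat br bc"
  shows "(block_mat br bc R C Q *\<^sub>v z) $ r =
    (\<Sum>j = 1..C. (Q (r div br + 1) j *\<^sub>v block bc z j) $ (r mod br))"
proof -
  let ?q = "\<lambda>j. Q (r div br + 1) j" and ?s = "r mod br"
  let ?f = "\<lambda>c. ?q (c div bc + 1) $$ (?s, c mod bc) * z $ c"
  have s: "?s < br" using block_row_index[OF r] by simp
  have "(block_mat br bc R C Q *\<^sub>v z) $ r = (\<Sum>c < C * bc. ?f c)"
    using r z by (auto simp: block_mat_def scalar_prod_def atLeast0LessThan mult.commute intro!: sum.cong)
  also have "\<dots> = (\<Sum>j < C. \<Sum>c = j * bc..<j * bc + bc. ?f c)"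
    by (rule sum.nat_group[symmetric])
  also have "\<dots> = (\<Sum>j < C. (?q (Suc j) *\<^sub>v block bc z (Suc j)) $ ?s)"
  proof (rule sum.cong[OF refl])
    fix j assume "j \<in> {..<C}"
    then have q: "?q (Suc j) \<in> carrier_mat br bc" using Q[of "Suc j"] by simp
    have "(\<Sum>c = j * bc..<j * bc + bc. ?f c) = (\<Sum>t = 0..<bc. ?f (t + j * bc))"
      using sum.shift_bounds_nat_ivl[of ?f 0 "j * bc" bc] by (simp add: add.commute)
    also have "\<dots> = (\<Sum>t = 0..<bc. ?q (Suc j) $$ (?s, t) * block bc z (Suc j) $ t)"
      by (rule sum.cong) (auto simp: block_def add.commute)
    also have "\<dots> = (?q (Suc j) *\<^sub>v block bc z (Suc j)) $ ?s"
      using q s block_carrier[of bc z "Suc j"] by (auto simp: scalar_prod_def intro!: sum.cong)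
    finally show "(\<Sum>c = j * bc..<j * bc + bc. ?f c) = (?q (Suc j) *\<^sub>v block bc z (Suc j)) $ ?s" .
  qed
  also have "\<dots> = (\<Sum>j = 1..C. (?q j *\<^sub>v block bc z j) $ ?s)"
    using sum.shift_bounds_Suc_ivl[of "\<lambda>j. (?q j *\<^sub>v block bc z j) $ ?s" 0 C]
    by (simp add: atLeast0LessThan atLeastLessThanSuc_atLeastAtMost)
  finally show ?thesis .
qed

lemma append_cols_carrier:
  assumes "A \<in> carrier_mat r c1" and "B \<in> carrier_mat r c2"
  shows "A @\<^sub>c B \<in> carrier_mat r (c1 + c2)"
  using assms by (auto simp: append_cols_def)

lemma append_cols_mult_vec:
  assumes A: "A \<in> carrier_mat r c1" and B: "B \<in> carrier_mat r c2"
    and x: "x \<in> carrier_vec c1" and u: "u \<in> carrier_vec c2"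
  shows "(A @\<^sub>c B) *\<^sub>v (x @\<^sub>v u) = A *\<^sub>v x + B *\<^sub>v u"
proof -
  have "(A @\<^sub>c B) *\<^sub>v (x @\<^sub>v u) =
      (A *\<^sub>v x + B *\<^sub>v u) @\<^sub>v (0\<^sub>m 0 c1 *\<^sub>v x + 0\<^sub>m 0 c2 *\<^sub>v u)"
    using A B by (auto simp: append_cols_def intro!: four_block_mat_mult_vec[OF A B _ _ x u])
  also have "\<dots> = A *\<^sub>v x + B *\<^sub>v u"
    using A B by (intro eq_vecI) auto
  finally show ?thesis .
qed

section \<open>The paired constraint rows of a stage\<close>

lemma uminus_add_uminus:
  fixes a b :: "real vec"
  assumes "a \<in> carrier_vec k" and "b \<in> carrier_vec k"
  shows "- a + - b = - (a + b)"
  using assms by (intro eq_vecI) auto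

lemma zero_mat_mult_vec:
  fixes v :: "real vec"
  assumes "v \<in> carrier_vec c"
  shows "0\<^sub>m r c *\<^sub>v v = 0\<^sub>v r"
  using assms by (intro eq_vecI) auto

lemma G_diag_mult_vec:
  assumes E: "E \<in> carrier_mat nw nx" and F: "F \<in> carrier_mat nw nu"
  shows "G_diag nx nu nw E F \<in> carrier_mat (4 * nx + 2 * nu + 2 * nw) (nx + nu)"
    and "x \<in> carrier_vec nx \<Longrightarrow> u \<in> carrier_vec nu \<Longrightarrow>
      G_diag nx nu nw E F *\<^sub>v (x @\<^sub>v u) =
      x @\<^sub>v - x @\<^sub>v (E *\<^sub>v x + F *\<^sub>v u) @\<^sub>v - (E *\<^sub>v x + F *\<^sub>v u) @\<^sub>v x @\<^sub>v - x @\<^sub>v u @\<^sub>v - u"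
proof -
  let ?X = "1\<^sub>m nx @\<^sub>c 0\<^sub>m nx nu :: real mat" and ?X' = "- 1\<^sub>m nx @\<^sub>c 0\<^sub>m nx nu :: real mat"
  let ?W = "E @\<^sub>c F" and ?W' = "- E @\<^sub>c - F"
  let ?U = "0\<^sub>m nu nx @\<^sub>c 1\<^sub>m nu :: real mat" and ?U' = "0\<^sub>m nu nx @\<^sub>c - 1\<^sub>m nu :: real mat"
  have car: "?X \<in> carrier_mat nx (nx + nu)" "?X' \<in> carrier_mat nx (nx + nu)"
    "?W \<in> carrier_mat nw (nx + nu)" "?W' \<in> carrier_mat nw (nx + nu)"
    "?U \<in> carrier_mat nu (nx + nu)" "?U' \<in> carrier_mat nu (nx + nu)"
    using E F by (auto intro!: append_cols_carrier)
  note tails = car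
    carrier_append_rows[OF car(5,6)]
    carrier_append_rows[OF car(2) carrier_append_rows[OF car(5,6)]]
    carrier_append_rows[OF car(1) carrier_append_rows[OF car(2) carrier_append_rows[OF car(5,6)]]]
    carrier_append_rows[OF car(4) carrier_append_rows[OF car(1)
      carrier_append_rows[OF car(2) carrier_append_rows[OF car(5,6)]]]]
    carrier_append_rows[OF car(3) carrier_append_rows[OF car(4) carrier_append_rows[OF car(1)
      carrier_append_rows[OF car(2) carrier_append_rows[OF car(5,6)]]]]]
    carrier_append_rows[OF car(2) carrier_append_rows[OF car(3) carrier_append_rows[OF car(4)
      carrier_append_rows[OF car(1) carrier_append_rows[OF car(2) carrier_append_rows[OF car(5,6)]]]]]]
  have height: "4 * nx + 2 * nu + 2 * nw = nx + (nx + (nw + (nw + (nx + (nx + (nu + nu))))))"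
    by simp
  show "G_diag nx nu nw E F \<in> carrier_mat (4 * nx + 2 * nu + 2 * nw) (nx + nu)"
    unfolding G_diag_def height by (rule carrier_append_rows[OF car(1) tails(12)])
  assume x: "x \<in> carrier_vec nx" and u: "u \<in> carrier_vec nu"
  have xu: "x @\<^sub>v u \<in> carrier_vec (nx + nu)" using x u by simp
  have rows: "?X *\<^sub>v (x @\<^sub>v u) = x" "?X' *\<^sub>v (x @\<^sub>v u) = - x"
    "?W *\<^sub>v (x @\<^sub>v u) = E *\<^sub>v x + F *\<^sub>v u" "?W' *\<^sub>v (x @\<^sub>v u) = - (E *\<^sub>v x + F *\<^sub>v u)"
    "?U *\<^sub>v (x @\<^sub>v u) = u" "?U' *\<^sub>v (x @\<^sub>v u) = - u"
    using E F x u
      append_cols_mult_vec[OF one_carrier_mat zero_carrier_mat x u]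
      append_cols_mult_vec[OF uminus_carrier_mat[OF one_carrier_mat] zero_carrier_mat x u]
      append_cols_mult_vec[OF zero_carrier_mat one_carrier_mat x u]
      append_cols_mult_vec[OF zero_carrier_mat uminus_carrier_mat[OF one_carrier_mat] x u]
    by (simp_all add: append_cols_mult_vec[of _ _ nx _ nu] uminus_add_uminus[of _ nw] zero_mat_mult_vec)
  show "G_diag nx nu nw E F *\<^sub>v (x @\<^sub>v u) =
      x @\<^sub>v - x @\<^sub>v (E *\<^sub>v x + F *\<^sub>v u) @\<^sub>v - (E *\<^sub>v x + F *\<^sub>v u) @\<^sub>v x @\<^sub>v - x @\<^sub>v u @\<^sub>v - u"
    unfolding G_diag_def
    by (simp only: mat_mult_append[OF tails(1) tails(12) xu] mat_mult_append[OF tails(2) tails(11) xu]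
      mat_mult_append[OF tails(3) tails(10) xu] mat_mult_append[OF tails(4) tails(9) xu]
      mat_mult_append[OF tails(1) tails(8) xu] mat_mult_append[OF tails(2) tails(7) xu]
      mat_mult_append[OF tails(5) tails(6) xu] rows)
qed

lemma G_sub_mult_vec:
  assumes A: "A \<in> carrier_mat nx nx" and B: "B \<in> carrier_mat nx nu"
  shows "G_sub nx nu nw A B \<in> carrier_mat (4 * nx + 2 * nu + 2 * nw) (nx + nu)"
    and "x \<in> carrier_vec nx \<Longrightarrow> u \<in> carrier_vec nu \<Longrightarrow>
      G_sub nx nu nw A B *\<^sub>v (x @\<^sub>v u) =
      - (A *\<^sub>v x + B *\<^sub>v u) @\<^sub>v (A *\<^sub>v x + B *\<^sub>v u) @\<^sub>v 0\<^sub>v (2 * nx + 2 * nu + 2 * nw)"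
proof -
  let ?V = "A @\<^sub>c B" and ?V' = "- A @\<^sub>c - B"
  let ?O = "0\<^sub>m (2 * nx + 2 * nu + 2 * nw) (nx + nu) :: real mat"
  have car: "?V \<in> carrier_mat nx (nx + nu)" "?V' \<in> carrier_mat nx (nx + nu)"
    "?O \<in> carrier_mat (2 * nx + 2 * nu + 2 * nw) (nx + nu)"
    using A B by (auto intro!: append_cols_carrier)
  note tail = carrier_append_rows[OF car(1,3)]
  have height: "4 * nx + 2 * nu + 2 * nw = nx + (nx + (2 * nx + 2 * nu + 2 * nw))"
    by simp
  show "G_sub nx nu nw A B \<in> carrier_mat (4 * nx + 2 * nu + 2 * nw) (nx + nu)"
    unfolding G_sub_def height by (rule carrier_append_rows[OF car(2) tail])
  assume x: "x \<in> carrier_vec nx" and u: "u \<in> carrier_vec nu"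
  have xu: "x @\<^sub>v u \<in> carrier_vec (nx + nu)" using x u by simp
  have rows: "?V *\<^sub>v (x @\<^sub>v u) = A *\<^sub>v x + B *\<^sub>v u" "?V' *\<^sub>v (x @\<^sub>v u) = - (A *\<^sub>v x + B *\<^sub>v u)"
    "?O *\<^sub>v (x @\<^sub>v u) = 0\<^sub>v (2 * nx + 2 * nu + 2 * nw)"
    using A B x u xu
    by (simp_all add: append_cols_mult_vec[of _ _ nx _ nu] uminus_add_uminus[of _ nx] zero_mat_mult_vec)
  show "G_sub nx nu nw A B *\<^sub>v (x @\<^sub>v u) =
      - (A *\<^sub>v x + B *\<^sub>v u) @\<^sub>v (A *\<^sub>v x + B *\<^sub>v u) @\<^sub>v 0\<^sub>v (2 * nx + 2 * nu + 2 * nw)"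
    unfolding G_sub_def by (simp only: mat_mult_append[OF car(2) tail xu] mat_mult_append[OF car(1,3) xu] rows)
qed

lemma G_block_carrier:
  assumes "2 \<le> i \<Longrightarrow> A (i - 1) \<in> carrier_mat nx nx \<and> B (i - 1) \<in> carrier_mat nx nu"
    and "E i \<in> carrier_mat nw nx \<and> F i \<in> carrier_mat nw nu"
  shows "G_block nx nu nw A B E F i j \<in> carrier_mat (4 * nx + 2 * nu + 2 * nw) (nx + nu)"
  using assms by (auto simp: G_block_def intro: G_diag_mult_vec(1) G_sub_mult_vec(1))

definition stage_rows :: "nat \<Rightarrow> (nat \<Rightarrow> nat \<Rightarrow> real mat) \<Rightarrow> real vec \<Rightarrow> nat \<Rightarrow> real vec" where
  "stage_rows n Q z i = Q i (i - 1) *\<^sub>v block n z (i - 1) + Q i i *\<^sub>v block n z i"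

text \<open>Block \<open>0\<close> of \<open>z\<close> is zero, which gives the first stage the same two-term form as the others.\<close>

lemma block_mat_mult_vec_bidiagonal:
  assumes r: "r < m * N" and z: "z \<in> carrier_vec (n * N)"
    and carrier: "\<And>i j. i \<in> {1..N} \<Longrightarrow> Q i j \<in> carrier_mat m n"
    and zero: "\<And>i j. i \<in> {1..N} \<Longrightarrow> j \<noteq> i \<Longrightarrow> j \<noteq> i - 1 \<Longrightarrow> Q i j = 0\<^sub>m m n"
  shows "(block_mat m n N N Q *\<^sub>v z) $ r = stage_rows n Q z (r div m + 1) $ (r mod m)"
proof -
  define i where "i = r div m + 1"
  define s where "s = r mod m"
  have i: "i \<in> {1..N}" and s: "s < m" using block_row_index[OF r] by (simp_all add: i_def s_def)
  let ?t = "\<lambda>j. (Q i j *\<^sub>v block n z j) $ s"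
  have "(block_mat m n N N Q *\<^sub>v z) $ r = (\<Sum>j = 1..N. ?t j)"
    using block_mat_mult_vec_index[OF r z, of Q] carrier i by (simp add: i_def s_def)
  also have "\<dots> = (\<Sum>j = 0..N. ?t j)"
  proof (rule sum.mono_neutral_left)
    show "\<forall>j \<in> {0..N} - {1..N}. ?t j = 0"
      using carrier[OF i, of 0] s by (auto simp: block_def not_less_eq_eq)
  qed auto
  also have "\<dots> = (\<Sum>j \<in> {i - 1, i}. ?t j)"
    using i zero[OF i] s block_carrier[of n z]
    by (intro sum.mono_neutral_right) (auto simp: zero_mat_mult_vec)
  also have "\<dots> = stage_rows n Q z i $ s"
    using i s carrier[OF i, THEN carrier_matD(1)] by (auto simp: stage_rows_def)
  finally show ?thesis by (simp add: i_def s_def)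
qed

text \<open>The dynamics rows are the only ones in which the previous stage enters; there \<open>a\<close> is
  \<open>x\<^sub>i - A\<^sub>i\<^sub>-\<^sub>1 x\<^sub>i\<^sub>-\<^sub>1 - B\<^sub>i\<^sub>-\<^sub>1 u\<^sub>i\<^sub>-\<^sub>1\<close>, or \<open>x\<^sub>1\<close> at the first stage. All
  other rows depend only on the stage's own variables \<open>x\<close> and \<open>u\<close>, which appear among them
  unchanged.\<close>

lemma stage_rows_paired:
  assumes i: "1 \<le> i"
    and AB: "2 \<le> i \<Longrightarrow> A (i - 1) \<in> carrier_mat nx nx \<and> B (i - 1) \<in> carrier_mat nx nu"
    and EF: "E i \<in> carrier_mat nw nx \<and> F i \<in> carrier_mat nw nu"
  obtains a b x u where "a \<in> carrier_vec nx" and "b \<in> carrier_vec nw"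
    and "x \<in> carrier_vec nx" and "u \<in> carrier_vec nu"
    and "block (nx + nu) z i = x @\<^sub>v u"
    and "stage_rows (nx + nu) (G_block nx nu nw A B E F) z i =
      a @\<^sub>v - a @\<^sub>v b @\<^sub>v - b @\<^sub>v x @\<^sub>v - x @\<^sub>v u @\<^sub>v - u"
proof -
  let ?n = "nx + nu" and ?Q = "G_block nx nu nw A B E F"
  define x where "x = vec_first (block ?n z i) nx"
  define u where "u = vec_last (block ?n z i) nu"
  have x: "x \<in> carrier_vec nx" and u: "u \<in> carrier_vec nu" by (simp_all add: x_def u_def)
  have xu: "block ?n z i = x @\<^sub>v u" by (simp add: x_def u_def block_carrier)
  define b where "b = E i *\<^sub>v x + F i *\<^sub>v u"
  define w where "w = b @\<^sub>v - b @\<^sub>v x @\<^sub>v - x @\<^sub>v u @\<^sub>v - u"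
  have b: "b \<in> carrier_vec nw" using EF x u by (auto simp: b_def intro!: add_carrier_vec mult_mat_vec_carrier)
  have w: "w \<in> carrier_vec (2 * nx + 2 * nu + 2 * nw)"
    by (rule carrier_vecI) (simp add: w_def b[THEN carrier_vecD] x[THEN carrier_vecD] u[THEN carrier_vecD])
  have diag: "?Q i i *\<^sub>v block ?n z i = x @\<^sub>v - x @\<^sub>v w"
    using G_diag_mult_vec(2)[of "E i" nw nx "F i" nu x u] EF x u
    by (simp add: G_block_def xu b_def w_def)
  (* the contribution of the previous stage, zero for the first stage *)
  obtain g where g: "g \<in> carrier_vec nx"
    and sub: "?Q i (i - 1) *\<^sub>v block ?n z (i - 1) = - g @\<^sub>v g @\<^sub>v 0\<^sub>v (2 * nx + 2 * nu + 2 * nw)"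
  proof (cases "2 \<le> i")
    case True
    define x0 where "x0 = vec_first (block ?n z (i - 1)) nx"
    define u0 where "u0 = vec_last (block ?n z (i - 1)) nu"
    have "block ?n z (i - 1) = x0 @\<^sub>v u0" by (simp add: x0_def u0_def block_carrier)
    moreover have "x0 \<in> carrier_vec nx" "u0 \<in> carrier_vec nu" by (simp_all add: x0_def u0_def)
    ultimately show ?thesis
      using True AB G_sub_mult_vec(2)[of "A (i - 1)" nx "B (i - 1)" nu x0 u0 nw]
      by (intro that[of "A (i - 1) *\<^sub>v x0 + B (i - 1) *\<^sub>v u0"]) (auto simp: G_block_def)
  next
    case False
    have "?Q i (i - 1) *\<^sub>v block ?n z (i - 1) = 0\<^sub>v (4 * nx + 2 * nu + 2 * nw)"
      using False i zero_mat_mult_vec[OF block_carrier[of ?n z 0]] by (simp add: G_block_def)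
    also have "\<dots> = - 0\<^sub>v nx @\<^sub>v 0\<^sub>v nx @\<^sub>v 0\<^sub>v (2 * nx + 2 * nu + 2 * nw)"
      by (intro eq_vecI) auto
    finally show ?thesis by (intro that[of "0\<^sub>v nx"]) auto
  qed
  define a where "a = - g + x"
  have neg: "g + - x = - a"
    using g x by (intro eq_vecI) (auto simp: a_def)
  have "stage_rows ?n ?Q z i = (- g @\<^sub>v g @\<^sub>v 0\<^sub>v (2 * nx + 2 * nu + 2 * nw)) + (x @\<^sub>v - x @\<^sub>v w)"
    unfolding stage_rows_def sub diag ..
  also have "\<dots> = (- g + x) @\<^sub>v ((g @\<^sub>v 0\<^sub>v (2 * nx + 2 * nu + 2 * nw)) + (- x @\<^sub>v w))"
    using g x w by (intro append_vec_add) auto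
  also have "(g @\<^sub>v 0\<^sub>v (2 * nx + 2 * nu + 2 * nw)) + (- x @\<^sub>v w) = - a @\<^sub>v w"
    using append_vec_add[of g nx "- x" "0\<^sub>v (2 * nx + 2 * nu + 2 * nw)"
        "2 * nx + 2 * nu + 2 * nw" w] g x w neg by simp
  finally have "stage_rows ?n ?Q z i = a @\<^sub>v - a @\<^sub>v w" by (simp add: a_def)
  moreover have "a \<in> carrier_vec nx" using g x by (simp add: a_def)
  ultimately show ?thesis using that[of a b x u] b x u xu by (simp add: w_def)
qed

lemma vec_antisym_uminus:
  fixes a a' :: "real vec"
  assumes "a \<le> a'" and "- a \<le> - a'"
  shows "a = a'"
  using assms by (intro eq_vecI) (force simp: less_eq_vec_def)+

lemma paired_le_imp_eq:
  fixes a a' w w' :: "real vec"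
  assumes a: "a \<in> carrier_vec k" and a': "a' \<in> carrier_vec k"
    and le: "a @\<^sub>v - a @\<^sub>v w \<le> a' @\<^sub>v - a' @\<^sub>v w'"
  shows "a = a'" and "w \<le> w'"
proof -
  have "a \<le> a'" and tail: "- a @\<^sub>v w \<le> - a' @\<^sub>v w'"
    using le append_vec_le[OF a a'] by auto
  moreover have "- a \<le> - a'" and "w \<le> w'"
    using tail append_vec_le[of "- a" k "- a'"] a a' by auto
  ultimately show "a = a'" and "w \<le> w'" by (auto intro: vec_antisym_uminus)
qed

text \<open>A row and its negative are both bounded below by their values at \<open>z'\<close>, so both inequalities are
  equalities; the rows that carry \<open>x\<close> and \<open>u\<close> then determine the whole stage.\<close>

lemma stage_rows_pinned:
  fixes z z' :: "real vec"
  assumes i: "1 \<le> i"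
    and AB: "2 \<le> i \<Longrightarrow> A (i - 1) \<in> carrier_mat nx nx \<and> B (i - 1) \<in> carrier_mat nx nu"
    and EF: "E i \<in> carrier_mat nw nx \<and> F i \<in> carrier_mat nw nu"
    and le: "stage_rows (nx + nu) (G_block nx nu nw A B E F) z' i
      \<le> stage_rows (nx + nu) (G_block nx nu nw A B E F) z i"
  shows "stage_rows (nx + nu) (G_block nx nu nw A B E F) z i =
      stage_rows (nx + nu) (G_block nx nu nw A B E F) z' i"
    and "block (nx + nu) z i = block (nx + nu) z' i"
proof -
  let ?Q = "G_block nx nu nw A B E F"
  obtain a b x u where c: "a \<in> carrier_vec nx" "b \<in> carrier_vec nw"
      "x \<in> carrier_vec nx" "u \<in> carrier_vec nu"
    and xu: "block (nx + nu) z i = x @\<^sub>v u"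
    and rows: "stage_rows (nx + nu) ?Q z i = a @\<^sub>v - a @\<^sub>v b @\<^sub>v - b @\<^sub>v x @\<^sub>v - x @\<^sub>v u @\<^sub>v - u"
    by (rule stage_rows_paired[where A = A and B = B and E = E and F = F and z = z, OF i AB EF])
  obtain a' b' x' u' where c': "a' \<in> carrier_vec nx" "b' \<in> carrier_vec nw"
      "x' \<in> carrier_vec nx" "u' \<in> carrier_vec nu"
    and xu': "block (nx + nu) z' i = x' @\<^sub>v u'"
    and rows': "stage_rows (nx + nu) ?Q z' i =
      a' @\<^sub>v - a' @\<^sub>v b' @\<^sub>v - b' @\<^sub>v x' @\<^sub>v - x' @\<^sub>v u' @\<^sub>v - u'"
    by (rule stage_rows_paired[where A = A and B = B and E = E and F = F and z = z', OF i AB EF])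
  note pa = paired_le_imp_eq[OF c'(1) c(1) le[unfolded rows rows']]
  note pb = paired_le_imp_eq[OF c'(2) c(2) pa(2)]
  note px = paired_le_imp_eq[OF c'(3) c(3) pb(2)]
  have "u' \<le> u" "- u' \<le> - u"
    using px(2) append_vec_le[OF c'(4) c(4)] by auto
  then have "u' = u" by (rule vec_antisym_uminus)
  with pa(1) pb(1) px(1) rows rows' xu xu'
  show "stage_rows (nx + nu) ?Q z i = stage_rows (nx + nu) ?Q z' i"
    and "block (nx + nu) z i = block (nx + nu) z' i" by simp_all
qed

section \<open>Prolongation along the coarse grid\<close>

lemma stacked_identity_carrier: "stacked_identity b L \<in> carrier_mat (b * L) b"
  by (simp add: stacked_identity_def block_mat_def)

lemma stacked_identity_index:
  assumes "r < b * L" and "c < b"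
  shows "stacked_identity b L $$ (r, c) = (if r mod b = c then 1 / sqrt (real L) else 0)"
  using assms by (simp add: stacked_identity_def block_mat_def)

text \<open>Locating the diagonal blocks by partial sums of arbitrary lengths \<open>l\<close> allows induction on the number
  of blocks. The grid points do not: without the last of them, the preceding interval would extend
  to \<open>N\<close>.\<close>

lemma diag_stacked_identity:
  fixes l :: "nat \<Rightarrow> nat" and b :: nat
  defines "D \<equiv> \<lambda>k. diag_block_mat (map (\<lambda>j. stacked_identity b (l j)) [1..<k + 1])"
  shows "D k \<in> carrier_mat (b * sum l {1..k}) (b * k)"
    and "r < b * sum l {1..k} \<Longrightarrow> c < b * k \<Longrightarrow>
      D k $$ (r, c) =
        (if r div b \<in> {sum l {1..c div b}..<sum l {1..c div b + 1}} \<and> r mod b = c mod b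
         then 1 / sqrt (real (l (c div b + 1))) else 0)"
proof (induction k arbitrary: r c)
  case 0
  { case 1 show ?case by (simp add: D_def) }
  { case 2 then show ?case by simp }
next
  case (Suc k)
  let ?S = "sum l {1..k}"
  have carrier: "D k \<in> carrier_mat (b * ?S) (b * k)" by (rule Suc.IH(1))
  have step: "D (Suc k) = four_block_mat (D k)
      (0\<^sub>m (b * ?S) b) (0\<^sub>m (b * l (Suc k)) (b * k)) (stacked_identity b (l (Suc k)))"
    using carrier stacked_identity_carrier[of b "l (Suc k)"]
    by (simp add: D_def diag_block_mat_last Let_def)
  {
    case 1
    show ?case
      using four_block_carrier_mat[OF carrier stacked_identity_carrier[of b "l (Suc k)"]]
      unfolding step by (simp add: algebra_simps)
  next
    case 2
    have b: "0 < b" using 2 by (cases b) auto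
    have r: "r < b * ?S + b * l (Suc k)" and c: "c < b * k + b"
      using 2 by (simp_all add: algebra_simps)
    have entry: "D (Suc k) $$ (r, c) =
        (if r < b * ?S then if c < b * k then D k $$ (r, c) else 0
         else if c < b * k then 0
         else stacked_identity b (l (Suc k)) $$ (r - b * ?S, c - b * k))"
      using carrier stacked_identity_carrier[of b "l (Suc k)"] r c
      unfolding step by (subst index_mat_four_block) auto
    have r_stage: "r < b * ?S \<longleftrightarrow> r div b < ?S"
      using b by (simp add: div_less_iff_less_mult mult.commute)
    have c_block: "c < b * k \<longleftrightarrow> c div b < k"
      using b by (simp add: div_less_iff_less_mult mult.commute)
    have mono: "sum l {1..j} \<le> sum l {1..k}" if "j \<le> k" for j
      using that by (intro sum_mono2) auto
    show ?case
    proof (cases "c < b * k")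
      case True
      then show ?thesis
        using Suc.IH(2)[of r c] mono[of "c div b + 1"] r_stage by (auto simp: entry c_block)
    next
      case False
      then have cdiv: "c div b = k"
        using c b by (intro div_nat_eqI) (auto simp: algebra_simps)
      have cmod: "c mod b = c - b * k"
        using cdiv by (simp add: minus_div_mult_eq_mod[symmetric] mult.commute)
      show ?thesis
      proof (cases "r < b * ?S")
        case True
        then show ?thesis using False r_stage by (auto simp: entry cdiv)
      next
        case rF: False
        have "(r - b * ?S) mod b = r mod b"
          using rF by (metis mod_mult_self2 le_add_diff_inverse2 not_less)
        moreover have "r div b < sum l {1..k} + l (Suc k)"
          using r b by (simp add: div_less_iff_less_mult algebra_simps)
        moreover have "c - b * k < b" using c False by simp
        moreover have "r - b * ?S < b * l (Suc k)" using r rF by simp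
        ultimately show ?thesis
          using False rF r_stage by (auto simp: entry stacked_identity_index cdiv cmod)
      qed
    qed
  }
qed

lemma coarse_grid_mono:
  assumes "coarse_grid N K M" and "j \<in> {1..K}" and "k \<in> {1..K}" and "j < k"
  shows "M j < M k"
  using assms unfolding coarse_grid_def strict_mono_on_def by blast

lemma interval_end_bounds:
  assumes "coarse_grid N K M" and "k \<in> {1..K}"
  shows "1 \<le> M k" and "M k \<le> interval_end N K M k"
proof -
  have range: "M j \<in> {1..N}" if "j \<in> {1..K}" for j
    using assms(1) that unfolding coarse_grid_def by blast
  show "1 \<le> M k" using range[OF assms(2)] by simp
  show "M k \<le> interval_end N K M k"
    using coarse_grid_mono[OF assms(1) assms(2), of "k + 1"] range[OF assms(2)] assms(2)
    by (auto simp: interval_end_def)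
qed

lemma sum_interval_length:
  assumes "coarse_grid N K M" and "k \<le> K"
  shows "sum (interval_length N K M) {1..k} = (if k = 0 then 0 else interval_end N K M k)"
  using assms(2)
proof (induction k)
  case 0
  then show ?case by simp
next
  case (Suc k)
  have "M (Suc k) = (if k = 0 then 0 else interval_end N K M k) + 1"
    using assms(1) Suc.prems interval_end_bounds(1)[OF assms(1), of "Suc k"]
    by (auto simp: coarse_grid_def interval_end_def)
  then show ?case
    using Suc interval_end_bounds(2)[OF assms(1), of "Suc k"]
    by (simp add: interval_length_def)
qed

lemma coarse_grid_covers:
  assumes "coarse_grid N K M" and "i \<in> {1..N}"
  obtains k where "k \<in> {1..K}" and "i \<in> {M k..interval_end N K M k}"
proof -
  let ?A = "{k \<in> {1..K}. M k \<le> i}"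
  define k where "k = Max ?A"
  have "1 \<in> ?A" using assms by (auto simp: coarse_grid_def)
  then have "k \<in> ?A" unfolding k_def by (intro Max_in) auto
  moreover have "i \<le> interval_end N K M k"
  proof (cases "k = K")
    case True
    then show ?thesis using assms by (simp add: interval_end_def)
  next
    case False
    have "j \<le> k" if "j \<in> ?A" for j using that unfolding k_def by (intro Max_ge) auto
    from this[of "k + 1"] have "k + 1 \<notin> ?A" by linarith
    then show ?thesis using False \<open>k \<in> ?A\<close> by (auto simp: interval_end_def)
  qed
  ultimately show ?thesis using that by auto
qed

lemma coarse_intervals_disjoint:
  assumes "coarse_grid N K M" and "j \<in> {1..K}" and "k \<in> {1..K}"
    and "i \<in> {M j..interval_end N K M j}" and "i \<in> {M k..interval_end N K M k}"
  shows "j = k"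
proof -
  have *: "\<not> j < k" if jk: "j \<in> {1..K}" "k \<in> {1..K}"
    "i \<in> {M j..interval_end N K M j}" "i \<in> {M k..interval_end N K M k}" for j k
  proof
    assume "j < k"
    then have "M (j + 1) \<le> M k"
      using coarse_grid_mono[OF assms(1), of "j + 1" k] jk by (cases "j + 1 = k") auto
    then show False using jk \<open>j < k\<close> interval_end_bounds(1)[OF assms(1), of "j + 1"] by (auto simp: interval_end_def)
  qed
  show ?thesis using *[of j k] *[of k j] assms(2-5) by force
qed

lemma prolongation_carrier:
  assumes "coarse_grid N K M"
  shows "prolongation b N K M \<in> carrier_mat (b * N) (b * K)"
  using diag_stacked_identity(1)[of b "interval_length N K M" K]
    sum_interval_length[OF assms, of K] assms
  by (simp add: prolongation_def interval_end_def coarse_grid_def)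

text \<open>The entries in terms of the grid: the partial sums of the interval lengths up to \<open>k - 1\<close> and \<open>k\<close>
  are \<open>M k - 1\<close> and the end of interval \<open>k\<close>.\<close>

lemma prolongation_index:
  assumes "coarse_grid N K M" and r: "r < b * N" and c: "c < b * K"
  shows "prolongation b N K M $$ (r, c) =
    (let k = c div b + 1 in
     if r div b + 1 \<in> {M k..interval_end N K M k} \<and> r mod b = c mod b
     then 1 / sqrt (real (interval_length N K M k)) else 0)"
proof -
  let ?l = "interval_length N K M"
  define k where "k = c div b + 1"
  have k: "k \<in> {1..K}"
    using c by (auto simp: k_def less_mult_imp_div_less mult.commute Suc_le_eq)
  have "sum ?l {1..K} = N"
    using sum_interval_length[OF assms(1), of K] assms(1) by (simp add: interval_end_def coarse_grid_def)
  moreover have hi: "sum ?l {1..k} = interval_end N K M k"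
    using sum_interval_length[OF assms(1), of k] k by simp
  moreover have lo: "sum ?l {1..k - 1} = M k - 1"
  proof -
    have "sum ?l {1..k} = sum ?l {1..k - 1} + ?l k"
      using sum.cl_ivl_Suc[of ?l 1 "k-1"] k by (auto simp del: sum.cl_ivl_Suc)
    then show ?thesis
      using hi interval_end_bounds(1,2)[OF assms(1) k] by (simp add: interval_length_def)
  qed
  ultimately have "prolongation b N K M $$ (r, c) =
      (if r div b \<in> {M k - 1..<interval_end N K M k} \<and> r mod b = c mod b
       then 1 / sqrt (real (?l k)) else 0)"
    using diag_stacked_identity(2)[of r b ?l K c] r c by (simp add: prolongation_def k_def)
  then show ?thesis
    using interval_end_bounds(1)[OF assms(1) k] unfolding Let_def k_def[symmetric] by auto
qed

text \<open>The transpose of a prolongation restricts a fine vector to the coarse grid, by scaled sums over the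
  intervals. The next lemmas say that this restriction is monotone, is local to an interval, and
  copies the entries of a one-stage interval.\<close>

lemma restriction_index:
  assumes "coarse_grid N K M" and "v \<in> carrier_vec (b * N)" and "c < b * K"
  shows "(transpose_mat (prolongation b N K M) *\<^sub>v v) $ c =
    (\<Sum>r < b * N. prolongation b N K M $$ (r, c) * v $ r)"
  using assms prolongation_carrier[OF assms(1), of b]
  by (auto simp: scalar_prod_def atLeast0LessThan intro!: sum.cong)

lemma restriction_mono:
  assumes grid: "coarse_grid N K M" and v: "v \<in> carrier_vec (b * N)" and le: "v \<le> w"
  shows "transpose_mat (prolongation b N K M) *\<^sub>v v \<le> transpose_mat (prolongation b N K M) *\<^sub>v w"
proof -
  let ?P = "prolongation b N K M"
  have w: "w \<in> carrier_vec (b * N)" using v le by (auto simp: less_eq_vec_def)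
  have "(transpose_mat ?P *\<^sub>v v) $ c \<le> (transpose_mat ?P *\<^sub>v w) $ c" if c: "c < b * K" for c
    unfolding restriction_index[OF grid v c] restriction_index[OF grid w c]
  proof (rule sum_mono)
    fix r assume r: "r \<in> {..<b * N}"
    have "0 \<le> ?P $$ (r, c)" using r c by (simp add: prolongation_index[OF grid] Let_def)
    then show "?P $$ (r, c) * v $ r \<le> ?P $$ (r, c) * w $ r"
      using le v r by (intro mult_left_mono) (auto simp: less_eq_vec_def)
  qed
  then show ?thesis using prolongation_carrier[OF grid, of b] by (auto simp: less_eq_vec_def)
qed

lemma restriction_cong:
  assumes grid: "coarse_grid N K M"
    and v: "v \<in> carrier_vec (b * N)" and w: "w \<in> carrier_vec (b * N)"
    and c: "c < b * K" and k: "k = c div b + 1"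
    and eq: "\<And>r. r < b * N \<Longrightarrow> r div b + 1 \<in> {M k..interval_end N K M k} \<Longrightarrow> v $ r = w $ r"
  shows "(transpose_mat (prolongation b N K M) *\<^sub>v v) $ c =
    (transpose_mat (prolongation b N K M) *\<^sub>v w) $ c"
  unfolding restriction_index[OF grid v c] restriction_index[OF grid w c]
  using eq c unfolding k by (intro sum.cong) (auto simp: prolongation_index[OF grid] Let_def)

lemma coarse_entry:
  fixes b k K r :: nat
  assumes "k \<in> {1..K}" and "r mod b < b"
  shows "(k - 1) * b + r mod b < b * K"
    and "((k - 1) * b + r mod b) div b + 1 = k"
    and "((k - 1) * b + r mod b) mod b = r mod b"
proof -
  have "(k - 1) * b + r mod b < (k - 1) * b + b" using assms(2) by simp
  also have "\<dots> = k * b" using assms(1) by (cases k) auto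
  also have "\<dots> \<le> b * K" using assms(1) by simp
  finally show "(k - 1) * b + r mod b < b * K" .
qed (use assms in auto)

lemma interval_length_eq_1:
  assumes "coarse_grid N K M" and "k \<in> {1..K}" and "interval_length N K M k = 1"
  shows "interval_end N K M k = M k"
  using assms interval_end_bounds[OF assms(1,2)] by (simp add: interval_length_def)

lemma restriction_singleton:
  assumes grid: "coarse_grid N K M" and v: "v \<in> carrier_vec (b * N)"
    and k: "k \<in> {1..K}" and len: "interval_length N K M k = 1"
    and r: "r < b * N" and stage: "r div b + 1 = M k"
  shows "(transpose_mat (prolongation b N K M) *\<^sub>v v) $ ((k - 1) * b + r mod b) = v $ r"
proof -
  note c = coarse_entry[OF k block_row_index(2)[OF r]]
  have entry: "prolongation b N K M $$ (s, (k - 1) * b + r mod b) = (if s = r then 1 else 0)"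
    if "s < b * N" for s
  proof -
    have "s = r" if "s div b + 1 = M k" "s mod b = r mod b"
      using that stage by (metis add_right_cancel div_mult_mod_eq)
    then show ?thesis
      using that stage len interval_length_eq_1[OF grid k len]
      by (auto simp: prolongation_index[OF grid that c(1)] c Let_def simp del: One_nat_def)
  qed
  have "(transpose_mat (prolongation b N K M) *\<^sub>v v) $ ((k - 1) * b + r mod b) =
      (\<Sum>s < b * N. if s = r then v $ s else 0)"
    unfolding restriction_index[OF grid v c(1)]
  proof (rule sum.cong[OF refl])
    fix s assume "s \<in> {..<b * N}"
    then show "prolongation b N K M $$ (s, (k - 1) * b + r mod b) * v $ s = (if s = r then v $ s else 0)"
      using entry[of s] by (cases "s = r") auto
  qed
  then show ?thesis using r by (simp add: sum.delta)
qed

text \<open>Vectors that are constant on each interval form the range of a prolongation. A vector that is zero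
  on all intervals with several stages is of this kind, since a one-stage interval imposes no
  condition.\<close>

lemma in_range_prolongation:
  assumes grid: "coarse_grid N K M" and x: "x \<in> carrier_vec (b * N)"
    and zero: "\<And>k r. k \<in> {1..K} \<Longrightarrow> interval_length N K M k \<noteq> 1 \<Longrightarrow> r < b * N \<Longrightarrow>
      r div b + 1 \<in> {M k..interval_end N K M k} \<Longrightarrow> x $ r = 0"
  obtains y where "y \<in> carrier_vec (b * K)" and "prolongation b N K M *\<^sub>v y = x"
proof -
  let ?P = "prolongation b N K M"
  define y where "y = vec (b * K) (\<lambda>c. let k = c div b + 1 in
    if interval_length N K M k = 1 then x $ ((M k - 1) * b + c mod b) else 0)"
  have "(?P *\<^sub>v y) $ r = x $ r" if r: "r < b * N" for r
  proof -
    obtain k where k: "k \<in> {1..K}" and i: "r div b + 1 \<in> {M k..interval_end N K M k}"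
      using coarse_grid_covers[OF grid block_row_index(1)[OF r]] .
    note c = coarse_entry[OF k block_row_index(2)[OF r]]
    let ?c = "(k - 1) * b + r mod b"
    have entry: "?P $$ (r, c) = (if c = ?c then 1 / sqrt (real (interval_length N K M k)) else 0)"
      if "c < b * K" for c
    proof (cases "r div b + 1 \<in> {M (c div b + 1)..interval_end N K M (c div b + 1)} \<and> r mod b = c mod b")
      case True
      have "c div b + 1 = k"
        using coarse_intervals_disjoint[OF grid _ k _ i] block_row_index(1)[OF that] True by blast
      then show ?thesis
        using True by (auto simp: prolongation_index[OF grid r that] Let_def)
    next
      case False
      then have "c \<noteq> ?c" using i c by metis
      then show ?thesis
        unfolding prolongation_index[OF grid r that] Let_def if_not_P[OF False] by simp
    qed
    have "(?P *\<^sub>v y) $ r = (\<Sum>c < b * K. ?P $$ (r, c) * y $ c)"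
      using prolongation_carrier[OF grid, of b] r
      by (auto simp: scalar_prod_def atLeast0LessThan y_def intro!: sum.cong)
    also have "\<dots> = (\<Sum>c < b * K. if c = ?c then y $ c / sqrt (real (interval_length N K M k)) else 0)"
      by (rule sum.cong) (auto simp: entry)
    also have "\<dots> = y $ ?c / sqrt (real (interval_length N K M k))"
      using c(1) by (simp add: sum.delta)
    also have "\<dots> = x $ r"
    proof (cases "interval_length N K M k = 1")
      case True
      have "r = (M k - 1) * b + r mod b"
        using i interval_length_eq_1[OF grid k True] by (metis add_diff_cancel_right' antisym atLeastAtMost_iff div_mult_mod_eq)
      then show ?thesis using True c by (simp add: y_def Let_def)
    next
      case False
      have "y $ ?c = 0" using False c by (simp add: y_def Let_def)
      then show ?thesis using zero[OF k False r i] by simp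
    qed
    finally show ?thesis .
  qed
  then have "?P *\<^sub>v y = x"
    using prolongation_carrier[OF grid, of b] x by (intro eq_vecI) auto
  then show ?thesis by (intro that[of y]) (auto simp: y_def)
qed

lemma free_indices_iff:
  assumes grid: "coarse_grid N K M" and "k \<in> {1..K}" and "i \<in> {M k..interval_end N K M k}"
  shows "i \<in> free_indices m N K M lo \<longleftrightarrow> k \<in> free_coarse m N K M lo"
proof
  assume "i \<in> free_indices m N K M lo"
  then obtain j where j: "j \<in> free_coarse m N K M lo" "i \<in> {M j..interval_end N K M j}"
    by (auto simp: free_indices_def)
  then have "j = k"
    using coarse_intervals_disjoint[OF grid _ assms(2) _ assms(3)] by (auto simp: free_coarse_def)
  then show "k \<in> free_coarse m N K M lo" using j by simp
qed (use assms in \<open>auto simp: free_indices_def\<close>)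

section \<open>Linear programs and their coarsening\<close>

text \<open>The prior guess cancels: shifting \<open>d\<close> by \<open>G zo\<close> makes the coarse constraints at \<open>y\<close> the
  restricted constraints at the projected point \<open>zo + T y\<close>.\<close>

lemma coarse_feasible_iff:
  assumes G: "G \<in> carrier_mat R C" and T: "T \<in> carrier_mat C c" and U: "U \<in> carrier_mat R r"
    and d: "d \<in> carrier_vec R" and zo: "zo \<in> carrier_vec C" and y: "y \<in> carrier_vec c"
  shows "lp_feasible (transpose_mat U *\<^sub>v (d - G *\<^sub>v zo)) (transpose_mat U * G * T) y \<longleftrightarrow>
    transpose_mat U *\<^sub>v d \<le> transpose_mat U *\<^sub>v (G *\<^sub>v (zo + T *\<^sub>v y))"
proof -
  let ?V = "transpose_mat U"
  have V: "?V \<in> carrier_mat r R" using U by simp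
  have Ty: "T *\<^sub>v y \<in> carrier_vec C" using T y by simp
  have "(?V * G * T) *\<^sub>v y = ?V *\<^sub>v (G *\<^sub>v (T *\<^sub>v y))"
    using V G T y Ty assoc_mult_mat_vec[of "?V * G" r C T c y] assoc_mult_mat_vec[OF V G Ty] by simp
  moreover have "?V *\<^sub>v (d - G *\<^sub>v zo) = ?V *\<^sub>v d - ?V *\<^sub>v (G *\<^sub>v zo)"
    using V G d zo by (intro mult_minus_distrib_mat_vec) auto
  moreover have "?V *\<^sub>v (G *\<^sub>v (zo + T *\<^sub>v y)) = ?V *\<^sub>v (G *\<^sub>v zo) + ?V *\<^sub>v (G *\<^sub>v (T *\<^sub>v y))"
    using V G zo Ty by (simp add: mult_add_distrib_mat_vec[of _ _ C] mult_add_distrib_mat_vec[of _ r R])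
  moreover have "dim_col (?V * G * T) = c" using T by simp
  ultimately show ?thesis
    using y V by (auto simp: lp_feasible_def less_eq_vec_def algebra_simps simp del: index_mult_mat_vec)
qed

text \<open>The coarse objective is the Lagrangian \<open>p \<bullet> z - lo \<bullet> G z\<close> at the projected point, up to the
  constant that it takes at \<open>zo\<close>.\<close>

lemma coarse_objective:
  fixes G T :: "real mat"
  assumes G: "G \<in> carrier_mat R C" and T: "T \<in> carrier_mat C c"
    and p: "p \<in> carrier_vec C" and lo: "lo \<in> carrier_vec R"
    and zo: "zo \<in> carrier_vec C" and y: "y \<in> carrier_vec c"
  shows "(transpose_mat T *\<^sub>v (p - transpose_mat G *\<^sub>v lo)) \<bullet> y =
    (p \<bullet> (zo + T *\<^sub>v y) - lo \<bullet> (G *\<^sub>v (zo + T *\<^sub>v y))) - (p \<bullet> zo - lo \<bullet> (G *\<^sub>v zo))"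
proof -
  have Ty: "T *\<^sub>v y \<in> carrier_vec C" using T y by simp
  have q: "transpose_mat G *\<^sub>v lo \<in> carrier_vec C" using G lo by simp
  have "(transpose_mat T *\<^sub>v (p - transpose_mat G *\<^sub>v lo)) \<bullet> y = (p - transpose_mat G *\<^sub>v lo) \<bullet> (T *\<^sub>v y)"
    using p q by (intro transpose_vec_mult_scalar[OF T y]) simp
  also have "\<dots> = p \<bullet> (T *\<^sub>v y) - lo \<bullet> (G *\<^sub>v (T *\<^sub>v y))"
    using minus_scalar_prod_distrib[OF p q Ty] transpose_vec_mult_scalar[OF G Ty lo] by simp
  also have "\<dots> = (p \<bullet> (zo + T *\<^sub>v y) - lo \<bullet> (G *\<^sub>v (zo + T *\<^sub>v y))) - (p \<bullet> zo - lo \<bullet> (G *\<^sub>v zo))"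
    using G lo zo Ty
    by (simp add: scalar_prod_add_distrib[OF p zo Ty] mult_add_distrib_mat_vec[OF G zo Ty]
      scalar_prod_add_distrib[OF lo])
  finally show ?thesis .
qed

text \<open>Under these conditions each point feasible for \<open>d'\<close> comes from a coarse feasible point, and the
  two objectives differ by a constant. As \<open>z'\<close> is feasible for \<open>d'\<close> and optimal for the coarse problem,
  the minimizers for \<open>d'\<close> are the feasible points that share its coarse objective value.\<close>

lemma solutions_transfer_to_coarse:
  assumes G: "G \<in> carrier_mat R C" and T: "T \<in> carrier_mat C c" and U: "U \<in> carrier_mat R r"
    and d: "d \<in> carrier_vec R" and p: "p \<in> carrier_vec C"
    and zo: "zo \<in> carrier_vec C" and lo: "lo \<in> carrier_vec R"
    and coarse: "projected_coarse_solution T U G d p zo lo z'"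
    and z': "lp_feasible d' G z'"
    and range: "\<And>z. lp_feasible d' G z \<Longrightarrow> \<exists>y \<in> carrier_vec c. z = zo + T *\<^sub>v y"
    and restricted: "\<And>z. lp_feasible d' G z \<Longrightarrow> transpose_mat U *\<^sub>v d \<le> transpose_mat U *\<^sub>v (G *\<^sub>v z)"
    and prices: "\<And>z. lp_feasible d' G z \<Longrightarrow> lo \<bullet> (G *\<^sub>v z) = lo \<bullet> (G *\<^sub>v z')"
  shows "lp_solution d' G p z'"
    and "lp_solution d' G p z \<Longrightarrow> projected_coarse_solution T U G d p zo lo z"
proof -
  let ?d = "transpose_mat U *\<^sub>v (d - G *\<^sub>v zo)" and ?G = "transpose_mat U * G * T"
  let ?p = "transpose_mat T *\<^sub>v (p - transpose_mat G *\<^sub>v lo)"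
  obtain y' where y': "lp_solution ?d ?G ?p y'" and z'_eq: "z' = zo + T *\<^sub>v y'"
    using coarse by (auto simp: projected_coarse_solution_def)
  have y'_car: "y' \<in> carrier_vec c" using y' T by (simp add: lp_solution_def lp_feasible_def)
  have lift: "\<exists>y. lp_feasible ?d ?G y \<and> z = zo + T *\<^sub>v y \<and> ?p \<bullet> y - ?p \<bullet> y' = p \<bullet> z - p \<bullet> z'"
    if z: "lp_feasible d' G z" for z
  proof -
    obtain y where y: "y \<in> carrier_vec c" and z_eq: "z = zo + T *\<^sub>v y" using range[OF z] by blast
    have "lp_feasible ?d ?G y"
      using coarse_feasible_iff[OF G T U d zo y] restricted[OF z] by (simp add: z_eq)
    moreover have "?p \<bullet> y - ?p \<bullet> y' = p \<bullet> z - p \<bullet> z'"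
      using coarse_objective[OF G T p lo zo y] coarse_objective[OF G T p lo zo y'_car] prices[OF z]
      by (simp add: z_eq[symmetric] z'_eq[symmetric])
    ultimately show ?thesis using z_eq by blast
  qed
  show "lp_solution d' G p z'"
    unfolding lp_solution_def using z' lift y' unfolding lp_solution_def by fastforce
  assume z: "lp_solution d' G p z"
  obtain y where y: "lp_feasible ?d ?G y" "z = zo + T *\<^sub>v y" "?p \<bullet> y - ?p \<bullet> y' = p \<bullet> z - p \<bullet> z'"
    using lift z by (auto simp: lp_solution_def)
  have "?p \<bullet> y \<le> ?p \<bullet> y'" using y(3) z z' by (auto simp: lp_solution_def)
  then have "lp_solution ?d ?G ?p y" using y(1) y' by (auto simp: lp_solution_def intro: order_trans)
  then show "projected_coarse_solution T U G d p zo lo z"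
    using y(2) by (auto simp: projected_coarse_solution_def)
qed

section \<open>The problem with fixed non-free stages\<close>

theorem lemma4:
  fixes N nx nu nw n m K :: nat
    and A B E F :: "nat \<Rightarrow> real mat"
    and M :: "nat \<Rightarrow> nat"
    and Gb :: "nat \<Rightarrow> nat \<Rightarrow> real mat"
    and G T U :: "real mat"
    and d p zo lo z' d' :: "real vec"
  assumes "1 \<le> N"
    and "n = nx + nu"
    and "m = 4 * nx + 2 * nu + 2 * nw"
    and "\<forall>i \<in> {1..N - 1}. A i \<in> carrier_mat nx nx \<and> B i \<in> carrier_mat nx nu"
    and "\<forall>i \<in> {1..N}. E i \<in> carrier_mat nw nx \<and> F i \<in> carrier_mat nw nu"
    and "Gb = G_block nx nu nw A B E F"
    and "G = block_mat m n N N Gb"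
    and "p \<in> carrier_vec (n * N)"
    and "d \<in> carrier_vec (m * N)"
    and "coarse_grid N K M"
    and "T = prolongation n N K M"
    and "U = prolongation m N K M"
    and "zo \<in> carrier_vec (n * N)"
    and "lo \<in> carrier_vec (m * N)"
    and "projected_coarse_solution T U G d p zo lo z'"
    and "d' = block_vec m N (\<lambda>i. if i \<in> free_indices m N K M lo then block m d i
           else Gb i (i - 1) *\<^sub>v block n z' (i - 1) + Gb i i *\<^sub>v block n z' i)"
  shows "(\<exists>z. lp_solution d' G p z) \<and>
         (\<forall>z. lp_solution d' G p z \<longrightarrow> projected_coarse_solution T U G d p zo lo z)"
proof -
  let ?V = "transpose_mat U" and ?S = "free_indices m N K M lo"
  note n = assms(2) and m = assms(3) and Gb = assms(6) and G = assms(7) and d = assms(9)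
    and grid = assms(10) and zo = assms(13) and lo = assms(14)
  have AB: "A (i - 1) \<in> carrier_mat nx nx \<and> B (i - 1) \<in> carrier_mat nx nu"
    if "i \<in> {1..N}" "2 \<le> i" for i
  proof -
    have "i - 1 \<in> {1..N - 1}" using that by (simp only: atLeastAtMost_iff) arith
    then show ?thesis using assms(4) by blast
  qed
  have EF: "E i \<in> carrier_mat nw nx \<and> F i \<in> carrier_mat nw nu" if "i \<in> {1..N}" for i
    using assms(5) that by blast
  have G_car: "G \<in> carrier_mat (m * N) (n * N)" by (simp add: G block_mat_def)
  have T_car: "T \<in> carrier_mat (n * N) (n * K)" and U_car: "U \<in> carrier_mat (m * N) (m * K)"
    using prolongation_carrier[OF grid] assms(11,12) by simp_all
  have Gz_car: "G *\<^sub>v z \<in> carrier_vec (m * N)" for z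
    using G_car by (intro carrier_vecI) simp
  have d'_car: "d' \<in> carrier_vec (m * N)" by (simp add: assms(16) block_vec_def)

  have Gb_car: "Gb i j \<in> carrier_mat m n" if "i \<in> {1..N}" for i j
    unfolding Gb n m using AB[OF that] EF[OF that] by (intro G_block_carrier) auto
  have G_rows: "(G *\<^sub>v z) $ r = stage_rows n Gb z (r div m + 1) $ (r mod m)"
    if "z \<in> carrier_vec (n * N)" "r < m * N" for z r
    unfolding G using that Gb_car
    by (intro block_mat_mult_vec_bidiagonal) (auto simp: Gb G_block_def n m)

  obtain y' where y': "lp_solution (?V *\<^sub>v (d - G *\<^sub>v zo)) (?V * G * T)
      (transpose_mat T *\<^sub>v (p - transpose_mat G *\<^sub>v lo)) y'" and z'_eq: "z' = zo + T *\<^sub>v y'"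
    using assms(15) by (auto simp: projected_coarse_solution_def)
  have y'_car: "y' \<in> carrier_vec (n * K)" using y' T_car by (simp add: lp_solution_def lp_feasible_def)
  have z'_car: "z' \<in> carrier_vec (n * N)" using z'_eq zo T_car y'_car by simp
  have coarse_z': "?V *\<^sub>v d \<le> ?V *\<^sub>v (G *\<^sub>v z')"
    using y' coarse_feasible_iff[OF G_car T_car U_car d zo y'_car]
    by (simp add: lp_solution_def z'_eq)

  have d'_index: "d' $ r = (if r div m + 1 \<in> ?S then d $ r else (G *\<^sub>v z') $ r)" if r: "r < m * N" for r
  proof -
    have "d' $ r = (if r div m + 1 \<in> ?S then block m d (r div m + 1) $ (r mod m)
        else stage_rows n Gb z' (r div m + 1) $ (r mod m))"
      using r by (simp add: assms(16) block_vec_def stage_rows_def)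
    then show ?thesis using block_index[OF r, of d] G_rows[OF z'_car r] by simp
  qed

  (* a free interval has length one, so its only stage is its first one *)
  have free: "\<exists>k \<in> {1..K}. interval_length N K M k = 1 \<and> i = M k \<and> block m lo i = 0\<^sub>v m"
    if i: "i \<in> ?S" for i
  proof -
    obtain k where k: "k \<in> free_coarse m N K M lo" and "i \<in> {M k..interval_end N K M k}"
      using i by (auto simp: free_indices_def)
    then have "k \<in> {1..K}" "interval_length N K M k = 1" "i = M k" "block m lo (M k) = 0\<^sub>v m"
      using interval_length_eq_1[OF grid, of k] by (auto simp: free_coarse_def)
    then show ?thesis by blast
  qed

  have z'_feasible: "lp_feasible d' G z'"
  proof -
    have "d' $ r \<le> (G *\<^sub>v z') $ r" if r: "r < m * N" for r
    proof (cases "r div m + 1 \<in> ?S")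
      case True
      obtain k where k: "k \<in> {1..K}" "interval_length N K M k = 1" "r div m + 1 = M k"
        using free[OF True] by blast
      (* on a one-stage interval the scaling factor is 1 and the coarse constraint is the original one *)
      let ?c = "(k - 1) * m + r mod m"
      have "(?V *\<^sub>v d) $ ?c \<le> (?V *\<^sub>v (G *\<^sub>v z')) $ ?c"
        using coarse_z' coarse_entry(1)[OF k(1) block_row_index(2)[OF r]] U_car
        by (simp add: less_eq_vec_def)
      then have "d $ r \<le> (G *\<^sub>v z') $ r"
        unfolding assms(12) restriction_singleton[OF grid d k(1,2) r k(3)]
          restriction_singleton[OF grid Gz_car k(1,2) r k(3)] .
      then show ?thesis using True by (simp add: d'_index[OF r])
    qed (simp add: d'_index[OF r])
    then show ?thesis
      using z'_car G_car d'_car by (simp add: lp_feasible_def less_eq_vec_def)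
  qed

  have restricted_d': "?V *\<^sub>v d \<le> ?V *\<^sub>v d'"
  proof -
    have "(?V *\<^sub>v d) $ c \<le> (?V *\<^sub>v d') $ c" if c: "c < m * K" for c
    proof -
      define k where "k = c div m + 1"
      have k: "k \<in> {1..K}" using block_row_index(1)[OF c] by (simp add: k_def)
      note in_S = free_indices_iff[OF grid k]
      show ?thesis
      proof (cases "k \<in> free_coarse m N K M lo")
        case True
        have "(?V *\<^sub>v d) $ c = (?V *\<^sub>v d') $ c"
          unfolding assms(12) using True in_S
          by (intro restriction_cong[OF grid d d'_car c k_def]) (simp add: d'_index)
        then show ?thesis by simp
      next
        case False
        have "(?V *\<^sub>v d') $ c = (?V *\<^sub>v (G *\<^sub>v z')) $ c"
          unfolding assms(12) using False in_S
          by (intro restriction_cong[OF grid d'_car Gz_car c k_def]) (simp add: d'_index)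
        then show ?thesis using coarse_z' c U_car by (simp add: less_eq_vec_def)
      qed
    qed
    then show ?thesis using U_car by (simp add: less_eq_vec_def)
  qed

  have pinned: "stage_rows n Gb z i = stage_rows n Gb z' i \<and> block n z i = block n z' i"
    if z: "lp_feasible d' G z" and i: "i \<in> {1..N}" "i \<notin> ?S" for z i
  proof -
    have z_car: "z \<in> carrier_vec (n * N)" using z G_car by (simp add: lp_feasible_def)
    have "stage_rows n Gb z' i $ s \<le> stage_rows n Gb z i $ s" if s: "s < m" for s
    proof -
      let ?r = "(i - 1) * m + s"
      have r: "?r < m * N" and stage: "?r div m + 1 = i" and offset: "?r mod m = s"
        using coarse_entry[of i N s m] i s by simp_all
      have "d' $ ?r \<le> (G *\<^sub>v z) $ ?r" using z r G_car by (simp add: lp_feasible_def less_eq_vec_def)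
      then have "(G *\<^sub>v z') $ ?r \<le> (G *\<^sub>v z) $ ?r" using d'_index[OF r] i stage by simp
      then show ?thesis using G_rows[OF z_car r] G_rows[OF z'_car r] stage offset by simp
    qed
    then have "stage_rows n Gb z' i \<le> stage_rows n Gb z i"
      using Gb_car[OF i(1), THEN carrier_matD(1)] by (simp add: less_eq_vec_def stage_rows_def)
    then show ?thesis
      using stage_rows_pinned[of i A nx B nu E nw F z' z] i AB EF unfolding Gb n by simp
  qed

  have range: "\<exists>y \<in> carrier_vec (n * K). z = zo + T *\<^sub>v y" if z: "lp_feasible d' G z" for z
  proof -
    have z_car: "z \<in> carrier_vec (n * N)" using z G_car by (simp add: lp_feasible_def)
    have diff: "z - z' \<in> carrier_vec (n * N)" using z_car z'_car by simp
    obtain w where w: "w \<in> carrier_vec (n * K)" "T *\<^sub>v w = z - z'"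
    proof (rule in_range_prolongation[OF grid diff])
      fix k r
      assume k: "k \<in> {1..K}" "interval_length N K M k \<noteq> 1" and r: "r < n * N"
        and i: "r div n + 1 \<in> {M k..interval_end N K M k}"
      have "r div n + 1 \<notin> ?S" using free_indices_iff[OF grid k(1) i] k by (simp add: free_coarse_def)
      then have "block n z (r div n + 1) = block n z' (r div n + 1)"
        using pinned[OF z block_row_index(1)[OF r]] by blast
      then have "z $ r = z' $ r" using block_index[OF r, of z] block_index[OF r, of z'] by simp
      then show "(z - z') $ r = 0" using r z_car z'_car by simp
    qed (use assms(11) that in simp)
    have "z = z' + T *\<^sub>v w" unfolding w(2) using z_car z'_car by (intro eq_vecI) auto
    also have "\<dots> = zo + T *\<^sub>v (y' + w)"
      unfolding mult_add_distrib_mat_vec[OF T_car y'_car w(1)] z'_eq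
      using w(1) zo T_car y'_car by (intro assoc_add_vec) auto
    finally show ?thesis using y'_car w(1) by (intro bexI[of _ "y' + w"]) auto
  qed

  have restricted: "?V *\<^sub>v d \<le> ?V *\<^sub>v (G *\<^sub>v z)" if z: "lp_feasible d' G z" for z
  proof -
    have "?V *\<^sub>v d' \<le> ?V *\<^sub>v (G *\<^sub>v z)"
      unfolding assms(12) using z by (intro restriction_mono[OF grid d'_car]) (simp add: lp_feasible_def)
    with restricted_d' show ?thesis by (rule order_trans)
  qed

  have prices: "lo \<bullet> (G *\<^sub>v z) = lo \<bullet> (G *\<^sub>v z')" if z: "lp_feasible d' G z" for z
  proof -
    have z_car: "z \<in> carrier_vec (n * N)" using z G_car by (simp add: lp_feasible_def)
    have "lo $ r * (G *\<^sub>v z) $ r = lo $ r * (G *\<^sub>v z') $ r" if r: "r < m * N" for r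
    proof (cases "r div m + 1 \<in> ?S")
      case True
      then have "lo $ r = 0"
        using free[OF True] block_index[OF r, of lo] block_row_index(2)[OF r] by auto
      then show ?thesis by simp
    next
      case False
      then show ?thesis
        using pinned[OF z block_row_index(1)[OF r]] G_rows[OF z_car r] G_rows[OF z'_car r] by simp
    qed
    then show ?thesis using G_car by (auto simp: scalar_prod_def simp del: index_mult_mat_vec intro!: sum.cong)
  qed

  note solutions = solutions_transfer_to_coarse[OF G_car T_car U_car d assms(8) zo lo assms(15)
    z'_feasible range restricted prices]
  show ?thesis using solutions by blast
qed

end
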